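(* Let $k,n$ be integers with $k\ge 4$ and $\ell(k-1)+1<n\le \ell(k)+1$, where $\ell(m)=\frac{m^3-m^2}{2}$. Then: (1) $\chi_{NL}(F_n)=k+1$; (2) $\chi_{NL}(W_n)=k+1$ if $n\neq\ell(k)$; (3) $\chi_{NL}(W_n)=k+2$ if $n=\ell(k)$.
   Context: All graphs are finite, simple, undirected and connected. The fan $F_n$ (resp. wheel $W_n$) of order $n$ is obtained from the path $P_{n-1}$ (resp. cycle $C_{n-1}$) of order $n-1$ by adding a new vertex adjacent to every vertex. A $k$-coloring of a graph $G$ is a partition of $V(G)$ into $k$ independent sets (colors). A coloring $\{S_1,\dots,S_k\}$ is neighbor-locating (an NL-coloring) if for any two distinct vertices $u,v$ in the same color class, $\{j: N(u)\cap S_j\neq\emptyset\}\neq\{j: N(v)\cap S_j\neq\emptyset\}$. The neighbor-locating chromatic number $\chi_{NL}(G)$ is the minimum number of colors in an NL-coloring of $G$. *)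

theory Defs
  imports "Graph_Theory.Graph_Theory" "HOL-Library.Disjoint_Sets"
begin

text \<open>
  A finite simple undirected graph is a \<^locale>\<open>pair_graph\<close>: a finite vertex set with a symmetric
  irreflexive arc relation, each edge being represented by its two opposite arcs.
\<close>

definition nbhd :: "'a pair_pre_digraph \<Rightarrow> 'a \<Rightarrow> 'a set" where
  "nbhd G u = {v. (u, v) \<in> parcs G}"

definition independent_set :: "'a pair_pre_digraph \<Rightarrow> 'a set \<Rightarrow> bool" where
  "independent_set G S \<longleftrightarrow> S \<subseteq> pverts G \<and> (\<forall>u\<in>S. \<forall>v\<in>S. (u, v) \<notin> parcs G)"

text \<open>
  A coloring is the set of its color classes; \<^const>\<open>partition_on\<close> requires them to be nonempty.
\<close>

definition coloring :: "'a pair_pre_digraph \<Rightarrow> 'a set set \<Rightarrow> bool" where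
  "coloring G P \<longleftrightarrow> partition_on (pverts G) P \<and> (\<forall>S\<in>P. independent_set G S)"

definition nbr_colors :: "'a pair_pre_digraph \<Rightarrow> 'a set set \<Rightarrow> 'a \<Rightarrow> 'a set set" where
  "nbr_colors G P u = {S \<in> P. nbhd G u \<inter> S \<noteq> {}}"

definition nl_coloring :: "'a pair_pre_digraph \<Rightarrow> 'a set set \<Rightarrow> bool" where
  "nl_coloring G P \<longleftrightarrow> coloring G P \<and>
     (\<forall>S\<in>P. \<forall>u\<in>S. \<forall>v\<in>S. u \<noteq> v \<longrightarrow> nbr_colors G P u \<noteq> nbr_colors G P v)"

definition chi_NL :: "'a pair_pre_digraph \<Rightarrow> nat" where
  "chi_NL G = (LEAST k. \<exists>P. nl_coloring G P \<and> card P = k)"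

definition path_graph :: "nat \<Rightarrow> nat pair_pre_digraph" where
  "path_graph m = \<lparr> pverts = {..<m}, parcs = {(i, j). i < m \<and> j < m \<and> (j = Suc i \<or> i = Suc j)} \<rparr>"

text \<open>The following is the cycle of order \<open>m\<close> for \<open>m \<ge> 3\<close>.\<close>

definition cycle_graph :: "nat \<Rightarrow> nat pair_pre_digraph" where
  "cycle_graph m = \<lparr> pverts = {..<m},
     parcs = {(i, j). i < m \<and> j < m \<and> (j = Suc i mod m \<or> i = Suc j mod m)} \<rparr>"

text \<open>The cone adds a new vertex \<^const>\<open>None\<close> adjacent to every vertex of the given graph.\<close>

definition cone :: "'a pair_pre_digraph \<Rightarrow> 'a option pair_pre_digraph" where
  "cone G = \<lparr> pverts = insert None (Some ` pverts G),
     parcs = map_prod Some Some ` parcs G \<union> {None} \<times> (Some ` pverts G) \<union> (Some ` pverts G) \<times> {None} \<rparr>"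

definition fan :: "nat \<Rightarrow> nat option pair_pre_digraph" where
  "fan n = cone (path_graph (n - 1))"

definition wheel :: "nat \<Rightarrow> nat option pair_pre_digraph" where
  "wheel n = cone (cycle_graph (n - 1))"

definition ell :: "nat \<Rightarrow> nat" where
  "ell m = (m ^ 3 - m ^ 2) div 2"

text \<open>In \<^const>\<open>ell\<close>, neither the subtraction nor the division on the naturals truncates.\<close>

lemma ell_real: "real (ell m) = (real m ^ 3 - real m ^ 2) / 2"
proof -
  have le: "m ^ 2 \<le> m ^ 3"
    by (cases m) (simp_all add: power_increasing)
  have "even (m ^ 3 - m ^ 2)"
    using le by simp
  then have "2 * ell m = m ^ 3 - m ^ 2"
    by (simp add: ell_def)
  then have "2 * real (ell m) = real (m ^ 3 - m ^ 2)"
    by (metis of_nat_mult of_nat_numeral)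
  then show ?thesis
    using le by (simp add: of_nat_diff)
qed

lemma pair_graph_path_graph: "pair_graph (path_graph m)"
proof -
  have "finite (parcs (path_graph m))"
    by (rule finite_subset[of _ "{..<m} \<times> {..<m}"]) (auto simp: path_graph_def)
  then show ?thesis
    by unfold_locales (auto simp: path_graph_def symmetric_def sym_def)
qed

lemma pair_graph_cycle_graph:
  assumes "m \<ge> 3"
  shows "pair_graph (cycle_graph m)"
proof -
  have fin: "finite (parcs (cycle_graph m))"
    by (rule finite_subset[of _ "{..<m} \<times> {..<m}"]) (auto simp: cycle_graph_def)
  have "i \<noteq> Suc i mod m" if "i < m" for i
    using assms that by (cases "Suc i = m") auto
  with fin show ?thesis
    by unfold_locales (force simp: cycle_graph_def symmetric_def sym_def)+
qed

lemma pair_graph_cone: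
  assumes "pair_graph G"
  shows "pair_graph (cone G)"
proof -
  interpret pair_graph G by (rule assms)
  have "finite (parcs (cone G))"
    by (simp add: cone_def)
  moreover have "sym (parcs G)"
    using pair_sym_arcs by (simp add: symmetric_def)
  ultimately show ?thesis
    by unfold_locales
      (auto simp: cone_def symmetric_def sym_def in_arcsD1 in_arcsD2 dest: pair_no_loops)
qed

lemma connected_cone:
  assumes "pair_graph G"
  shows "connected (with_proj (cone G))"
proof -
  interpret C: pair_graph "cone G" by (rule pair_graph_cone[OF assms])
  have hub: "u \<rightarrow>\<^sup>*\<^bsub>with_proj (cone G)\<^esub> None \<and> None \<rightarrow>\<^sup>*\<^bsub>with_proj (cone G)\<^esub> u"
    if "u \<in> pverts (cone G)" for u
  proof (cases "u = None")
    case True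
    then show ?thesis using that by simp
  next
    case False
    then have "(u, None) \<in> parcs (cone G)" "(None, u) \<in> parcs (cone G)"
      using that by (auto simp: cone_def)
    then show ?thesis by (auto intro: C.reachable_adjI)
  qed
  have "strongly_connected (with_proj (cone G))"
  proof (rule strongly_connectedI)
    show "verts (with_proj (cone G)) \<noteq> {}" by (simp add: cone_def)
    show "u \<rightarrow>\<^sup>*\<^bsub>with_proj (cone G)\<^esub> v"
      if "u \<in> verts (with_proj (cone G))" "v \<in> verts (with_proj (cone G))" for u v
      using hub[of u] hub[of v] that by (auto intro: C.reachable_trans[of u None v])
  qed
  then show ?thesis
    using C.reachable_mk_symmetric_eq[OF C.pair_sym_arcs]
    by (simp add: connected_def strongly_connected_def mk_symmetric_def)
qed

text \<open>The minimum in the definition of \<^const>\<open>chi_NL\<close> is attained: singletons form an NL-coloring.\<close>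

lemma nl_coloring_singletons:
  assumes "pair_graph G"
  shows "nl_coloring G ((\<lambda>v. {v}) ` pverts G)"
proof -
  interpret pair_graph G by (rule assms)
  show ?thesis
    using pair_no_loops
    by (fastforce simp: nl_coloring_def coloring_def independent_set_def partition_on_def disjoint_def)
qed

lemma chi_NL_attained:
  assumes "pair_graph G"
  shows "\<exists>P. nl_coloring G P \<and> card P = chi_NL G"
  unfolding chi_NL_def by (rule LeastI_ex) (use nl_coloring_singletons[OF assms] in blast)

end

theory Submission
  imports Defs
begin

text \<open>
  In a cone the apex is alone in its colour, so NL-colorings of the cone with \<open>k + 1\<close> colours are
  colorings of the rim with \<open>k\<close> colours in which the type \<open>(colour, set of neighbour colours)\<close>
  determines the vertex. On a path or cycle the neighbour set has one or two colours, which leaves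
  \<open>ell k\<close> types and gives the lower bounds. The types with \<open>k\<close> colours split into those of the
  closed words \<open>a b\<close> (digons) and \<open>a b c\<close> (triangles), which can be spliced into a word
  wherever it uses one of their edges. Hence every length \<open>2 d + 3 t\<close> can be built, that is, every
  relevant length up to \<open>ell k\<close> except \<open>ell k - 1\<close>. For that length, a path exists by deleting a
  vertex from a longest word, while a cycle would miss exactly one type, contradicting that as many
  arcs lead from colour \<open>i\<close> to colour \<open>a\<close> as back.
\<close>

section \<open>Pointed colour sets\<close>

text \<open>A vertex of colour \<open>x\<close> whose neighbours have colour set \<open>N\<close> is encoded as the set
  \<open>S = insert x N\<close> with base point \<open>x\<close>; on a path or cycle, \<open>S\<close> has two or three elements.\<close>

definition pointed :: "'a set set \<Rightarrow> ('a \<times> 'a set) set" where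
  "pointed F = {(x, N). x \<notin> N \<and> insert x N \<in> F}"

definition pieces :: "'a set \<Rightarrow> 'a set set" where
  "pieces A = {S. S \<subseteq> A \<and> (card S = 2 \<or> card S = 3)}"

lemma pointed_eq: "pointed F = (\<lambda>(S, x). (x, S - {x})) ` (SIGMA S:F. S)"
proof (intro subset_antisym subsetI)
  fix t assume "t \<in> pointed F"
  then obtain x N where t: "t = (x, N)" "x \<notin> N" "insert x N \<in> F"
    by (auto simp: pointed_def)
  then show "t \<in> (\<lambda>(S, x). (x, S - {x})) ` (SIGMA S:F. S)"
    by (intro image_eqI[of _ _ "(insert x N, x)"]) auto
qed (auto simp: pointed_def insert_absorb)

lemma inj_on_pointed: "inj_on (\<lambda>(S, x). (x, S - {x})) (SIGMA S:F. S)"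
  by (clarsimp simp: inj_on_def) blast

text \<open>A set \<open>S\<close> contributes one pair \<open>(x, S - {x})\<close> per base point,
  and \<open>S\<close> can be read back from the pair.\<close>

lemma card_pointed:
  assumes "finite F" "\<And>S. S \<in> F \<Longrightarrow> finite S"
  shows "card (pointed F) = (\<Sum>S\<in>F. card S)"
  using assms by (simp add: pointed_eq card_image[OF inj_on_pointed])

lemma pointed_empty: "pointed {} = {}"
  by (simp add: pointed_def)

lemma pointed_insert: "pointed (insert S F) = pointed F \<union> (\<lambda>x. (x, S - {x})) ` S"
  unfolding pointed_eq by force

lemma finite_pieces: "finite A \<Longrightarrow> finite (pieces A)"
  by (rule finite_subset[of _ "Pow A"]) (auto simp: pieces_def)

lemma finite_piece: "S \<in> pieces A \<Longrightarrow> finite S"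
  by (auto simp: pieces_def intro: card_ge_0_finite)

text \<open>Identifies \<open>ell k\<close> as the number of types over \<open>k\<close> colours:
  three per 3-subset, two per 2-subset. The induction follows Pascal's rule, over the reals so that
  nothing truncates.\<close>

lemma choose_ell: "3 * (k choose 3) + 2 * (k choose 2) = ell k"
proof -
  have "real (3 * (k choose 3) + 2 * (k choose 2)) = real (ell k)"
  proof (induction k)
    case 0
    then show ?case by (simp add: ell_def numeral_eq_Suc)
  next
    case (Suc k)
    have "Suc k choose 3 = (k choose 2) + (k choose 3)"
      by (simp add: eval_nat_numeral)
    moreover have "Suc k choose 2 = k + (k choose 2)"
      by (simp add: eval_nat_numeral)
    moreover have "real (k choose 2) = real k * (real k - 1) / 2"
      by (cases k) (simp_all add: choose_two real_of_nat_div algebra_simps)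
    ultimately show ?case using Suc
      by (simp add: ell_real field_simps power2_eq_square power3_eq_cube)
  qed
  then show ?thesis
    by (simp only: of_nat_eq_iff)
qed

lemma card_pointed_pieces:
  assumes "finite A"
  shows "card (pointed (pieces A)) = ell (card A)"
proof -
  have split: "pieces A = {S. S \<subseteq> A \<and> card S = 2} \<union> {S. S \<subseteq> A \<and> card S = 3}"
    by (auto simp: pieces_def)
  have fin: "finite {S. S \<subseteq> A \<and> card S = j}" for j
    by (rule finite_subset[of _ "Pow A"]) (use assms in auto)
  have "card (pointed (pieces A)) = (\<Sum>S\<in>pieces A. card S)"
    by (rule card_pointed) (use assms finite_pieces finite_piece in auto)
  also have "\<dots> = (\<Sum>S | S \<subseteq> A \<and> card S = 2. card S) + (\<Sum>S | S \<subseteq> A \<and> card S = 3. card S)"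
    unfolding split by (rule sum.union_disjoint) (use fin in auto)
  also have "\<dots> = 2 * (card A choose 2) + 3 * (card A choose 3)"
    by (simp add: n_subsets[OF assms])
  finally show ?thesis using choose_ell[of "card A"] by simp
qed

lemma ell_mono: "j \<le> k \<Longrightarrow> ell j \<le> ell k"
  unfolding choose_ell[symmetric] by (intro add_mono mult_le_mono2 binomial_right_mono)

section \<open>Colorings of cones and counting\<close>

text \<open>Rim version of an NL-coloring: every rim vertex sees the apex, so the colour of the apex
  separates no two of them. The colour type is free because the lower bound uses colour classes and
  the words use numbers.\<close>

definition nl_map :: "'a pair_pre_digraph \<Rightarrow> ('a \<Rightarrow> 'b) \<Rightarrow> bool" where
  "nl_map G c \<longleftrightarrow> (\<forall>u\<in>pverts G. c u \<notin> c ` nbhd G u) \<and>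
     inj_on (\<lambda>u. (c u, c ` nbhd G u)) (pverts G)"

lemma nl_map_eqD:
  "\<lbrakk>nl_map G c; u \<in> pverts G; v \<in> pverts G; c u = c v; c ` nbhd G u = c ` nbhd G v\<rbrakk> \<Longrightarrow> u = v"
  unfolding nl_map_def by (elim conjE, erule inj_onD[of _ _ u v]) simp_all

lemma nbhd_cone_Some: "u \<in> pverts G \<Longrightarrow> nbhd (cone G) (Some u) = insert None (Some ` nbhd G u)"
  by (auto simp: nbhd_def cone_def)

lemma pverts_cone: "pverts (cone G) = insert None (Some ` pverts G)"
  by (simp add: cone_def)

lemma nbhd_subset: "pair_graph G \<Longrightarrow> nbhd G u \<subseteq> pverts G"
proof -
  assume "pair_graph G"
  then interpret pair_graph G .
  show ?thesis by (auto simp: nbhd_def dest: in_arcsD2)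
qed

text \<open>The fibres of \<open>c\<close> together with \<open>{None}\<close> form the coloring.
  Each rim vertex sees \<open>{None}\<close> and the fibres of its neighbours' colours, and distinct
  colours in use have distinct fibres.\<close>

lemma chi_NL_cone_le:
  assumes G: "pair_graph G" and c: "nl_map G c"
  shows "chi_NL (cone G) \<le> card (c ` pverts G) + 1"
proof -
  interpret pair_graph G by (rule G)
  define V where "V = pverts G"
  define cls where "cls i = Some ` {v \<in> V. c v = i}" for i
  define P where "P = insert {None} (cls ` c ` V)"
  have "finite V" by (simp add: V_def)
  have N: "nbhd G u \<subseteq> V" for u using nbhd_subset[OF G] by (simp add: V_def)
  have cls_mem: "Some v \<in> cls i \<longleftrightarrow> v \<in> V \<and> c v = i" "None \<notin> cls i" for v i
    by (auto simp: cls_def)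
  have inj: "inj_on cls (c ` V)"
    by (rule inj_onI) (metis cls_mem(1) imageE)
  have part: "partition_on (pverts (cone G)) P"
  proof (rule partition_onI)
    show "\<Union>P = pverts (cone G)"
      by (auto simp: P_def pverts_cone cls_def V_def)
    show "{} \<notin> P"
      by (auto simp: P_def cls_def)
    show "disjnt p q" if "p \<in> P" "q \<in> P" "p \<noteq> q" for p q
      using that by (auto simp: P_def disjnt_def cls_def)
  qed
  have ind: "independent_set (cone G) S" if SP: "S \<in> P" for S
    unfolding independent_set_def
  proof (intro conjI ballI)
    show "S \<subseteq> pverts (cone G)" using that part by (auto simp: partition_on_def)
    fix u v assume "u \<in> S" "v \<in> S"
    show "(u, v) \<notin> parcs (cone G)"
    proof (cases "S = {None}")
      case True
      then show ?thesis using \<open>u \<in> S\<close> \<open>v \<in> S\<close> by (auto simp: cone_def)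
    next
      case False
      with SP have "S \<in> cls ` c ` V" by (simp add: P_def)
      then obtain i where i: "S = cls i" by blast
      obtain x where x: "u = Some x" "x \<in> V" "c x = i"
        using \<open>u \<in> S\<close> unfolding i cls_def by blast
      obtain y where y: "v = Some y" "y \<in> V" "c y = i"
        using \<open>v \<in> S\<close> unfolding i cls_def by blast
      have "y \<notin> nbhd G x"
        using c x(2,3) y(3) by (metis V_def image_eqI nl_map_def)
      then show ?thesis by (auto simp: x y cone_def nbhd_def)
    qed
  qed
  have cols: "nbr_colors (cone G) P (Some u) = insert {None} (cls ` c ` nbhd G u)" if "u \<in> V" for u
  proof -
    have "nbhd (cone G) (Some u) \<inter> cls (c v) \<noteq> {} \<longleftrightarrow> cls (c v) \<in> cls ` c ` nbhd G u" if "v \<in> V" for v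
    proof -
      have "nbhd (cone G) (Some u) \<inter> cls (c v) \<noteq> {} \<longleftrightarrow> (\<exists>w\<in>nbhd G u. Some w \<in> cls (c v))"
        using \<open>u \<in> V\<close> cls_mem(2)[of "c v"] by (auto simp: nbhd_cone_Some V_def[symmetric])
      also have "\<dots> \<longleftrightarrow> c v \<in> c ` nbhd G u"
        unfolding cls_mem(1) image_iff using N[of u] by (metis subsetD)
      also have "\<dots> \<longleftrightarrow> cls (c v) \<in> cls ` c ` nbhd G u"
        using inj_on_image_mem_iff[OF inj, of "c v" "c ` nbhd G u"] that N[of u] by (auto simp: image_mono)
      finally show ?thesis .
    qed
    then show ?thesis
      using \<open>u \<in> V\<close> N[of u]
      by (auto simp: nbr_colors_def P_def nbhd_cone_Some V_def[symmetric])
  qed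
  have "nbr_colors (cone G) P u \<noteq> nbr_colors (cone G) P v"
    if S: "S \<in> P" "u \<in> S" "v \<in> S" and "u \<noteq> v" for S u v
  proof
    have "S \<noteq> {None}" using S \<open>u \<noteq> v\<close> by blast
    with S have "S \<in> cls ` c ` V" by (simp add: P_def)
    then obtain i where i: "S = cls i" by blast
    obtain x where x: "u = Some x" "x \<in> V" "c x = i"
      using \<open>u \<in> S\<close> unfolding i cls_def by blast
    obtain y where y: "v = Some y" "y \<in> V" "c y = i"
      using \<open>v \<in> S\<close> unfolding i cls_def by blast
    assume eq: "nbr_colors (cone G) P u = nbr_colors (cone G) P v"
    have "{None} \<notin> cls ` A" for A using cls_mem(2) by force
    then have "cls ` c ` nbhd G x = cls ` c ` nbhd G y"
      using eq x y cols by (simp add: insert_ident)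
    then have "c ` nbhd G x = c ` nbhd G y"
      using inj_on_image_eq_iff[OF inj] N by (meson image_mono)
    then have "x = y"
      using nl_map_eqD[OF c, of x y] x y by (simp add: V_def)
    then show False using \<open>u \<noteq> v\<close> x y by simp
  qed
  then have "nl_coloring (cone G) P"
    using part ind by (auto simp: nl_coloring_def coloring_def)
  then have "chi_NL (cone G) \<le> card P"
    unfolding chi_NL_def by (intro Least_le) auto
  also have "\<dots> \<le> card (cls ` c ` V) + 1"
    using \<open>finite V\<close> by (simp add: P_def card_insert_if)
  also have "\<dots> \<le> card (c ` V) + 1"
    using \<open>finite V\<close> by (simp add: card_image_le)
  finally show ?thesis by (simp add: V_def)
qed

text \<open>\<open>c\<close> sends a rim vertex to its class in an optimal NL-coloring, hence the
  colour type. Being adjacent to all other vertices, the apex forms a class alone, which is the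
  \<open>+ 1\<close>.\<close>

lemma chi_NL_cone_attained:
  fixes G :: "'a pair_pre_digraph"
  assumes G: "pair_graph G"
  shows "\<exists>c :: 'a \<Rightarrow> 'a option set. nl_map G c \<and> card (c ` pverts G) + 1 = chi_NL (cone G)"
proof -
  interpret pair_graph G by (rule G)
  obtain P where P: "nl_coloring (cone G) P" "card P = chi_NL (cone G)"
    using chi_NL_attained[OF pair_graph_cone[OF G]] by blast
  define V where "V = pverts G"
  have N: "nbhd G u \<subseteq> V" for u using nbhd_subset[OF G] by (simp add: V_def)
  have part: "partition_on (insert None (Some ` V)) P"
    using P(1) by (simp add: nl_coloring_def coloring_def pverts_cone V_def)
  have ind: "(u, v) \<notin> parcs (cone G)" if "S \<in> P" "u \<in> S" "v \<in> S" for S u v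
    using P(1) that by (simp add: nl_coloring_def coloring_def independent_set_def)
  have nl: "u = v" if "S \<in> P" "u \<in> S" "v \<in> S"
    "nbr_colors (cone G) P u = nbr_colors (cone G) P v" for S u v
    using P(1) that unfolding nl_coloring_def by metis
  have uniq: "S = T" if "S \<in> P" "T \<in> P" "x \<in> S" "x \<in> T" for S T x
    using part that by (auto simp: partition_on_def disjoint_def)
  have "\<forall>u\<in>V. \<exists>S. S \<in> P \<and> Some u \<in> S"
    using part by (auto simp: partition_on_def)
  then obtain c where c: "\<And>u. u \<in> V \<Longrightarrow> c u \<in> P" "\<And>u. u \<in> V \<Longrightarrow> Some u \<in> c u"
    by metis
  obtain S where S: "S \<in> P" "None \<in> S"
    using part by (auto simp: partition_on_def)
  have "S \<subseteq> insert None (Some ` V)"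
    using part S by (auto simp: partition_on_def)
  moreover have "Some u \<notin> S" if "u \<in> V" for u
    using ind[OF S(1,2), of "Some u"] that by (auto simp: cone_def V_def)
  ultimately have "S = {None}" using S(2) by auto
  have P_eq: "P = insert {None} (c ` V)"
  proof (intro subset_antisym subsetI)
    fix T assume T: "T \<in> P"
    then have "T \<noteq> {}" "T \<subseteq> insert None (Some ` V)"
      using part by (auto simp: partition_on_def)
    then consider "None \<in> T" | u where "u \<in> V" "Some u \<in> T"
      by blast
    then show "T \<in> insert {None} (c ` V)"
      by cases (use uniq T S c \<open>S = {None}\<close> in blast)+
  qed (use S c \<open>S = {None}\<close> in auto)
  have "{None} \<notin> c ` V"
    using c by force
  then have card: "card (c ` V) + 1 = card P"
    by (simp add: P_eq V_def)
  have cols: "nbr_colors (cone G) P (Some u) = insert {None} (c ` nbhd G u)" if "u \<in> V" for u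
  proof -
    have nb: "nbhd (cone G) (Some u) = insert None (Some ` nbhd G u)"
      using that by (simp add: nbhd_cone_Some V_def)
    have "c v \<in> c ` nbhd G u" if "v \<in> V" "w \<in> nbhd G u" "Some w \<in> c v" for v w
      using uniq[of "c v" "c w" "Some w"] c that N[of u] by auto
    moreover have "Some w \<in> c w" if "w \<in> nbhd G u" for w
      using c(2) that N[of u] by auto
    moreover have "None \<notin> c v" if "v \<in> V" for v
      using uniq[of "c v" S None] S c(1,2)[OF that] \<open>S = {None}\<close> by auto
    ultimately show ?thesis
      using N[of u] unfolding nbr_colors_def nb P_eq by auto
  qed
  have "nl_map G c"
    unfolding nl_map_def
  proof (intro conjI ballI inj_onI)
    fix u assume "u \<in> pverts G"
    show "c u \<notin> c ` nbhd G u"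
    proof
      assume "c u \<in> c ` nbhd G u"
      then obtain v where v: "v \<in> nbhd G u" "c u = c v" by auto
      then have "(Some u, Some v) \<in> parcs (cone G)"
        by (force simp: nbhd_def cone_def)
      moreover have "v \<in> V" "u \<in> V" using N v \<open>u \<in> pverts G\<close> by (auto simp: V_def)
      ultimately show False using ind[of "c u" "Some u" "Some v"] c v(2) by metis
    qed
  next
    fix u v assume uv: "u \<in> pverts G" "v \<in> pverts G" "(c u, c ` nbhd G u) = (c v, c ` nbhd G v)"
    then show "u = v"
      using nl[of "c u" "Some u" "Some v"] c(1)[of u] c(2)[of u] c(2)[of v] cols[of u] cols[of v]
      by (simp add: V_def)
  qed
  with card P(2) show ?thesis by (auto simp: V_def)
qed

section \<open>Types on graphs with all degrees one or two\<close>

lemma colors_in_pointed: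
  assumes G: "pair_graph G" and c: "nl_map G c"
    and deg: "\<And>u. u \<in> pverts G \<Longrightarrow> card (nbhd G u) = 1 \<or> card (nbhd G u) = 2"
    and u: "u \<in> pverts G"
  shows "(c u, c ` nbhd G u) \<in> pointed (pieces (c ` pverts G))"
proof -
  have nt: "c u \<notin> c ` nbhd G u" using c u by (auto simp: nl_map_def)
  have fin: "finite (nbhd G u)" and ne: "nbhd G u \<noteq> {}"
    using deg[OF u] by (auto intro: card_ge_0_finite)
  have "card (c ` nbhd G u) \<le> 2"
    using card_image_le[OF fin, of c] deg[OF u] by auto
  moreover have "card (c ` nbhd G u) > 0"
    using fin ne by (simp add: card_gt_0_iff)
  ultimately have "card (insert (c u) (c ` nbhd G u)) = 2 \<or> card (insert (c u) (c ` nbhd G u)) = 3"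
    using nt fin by auto
  then show ?thesis
    using nt u nbhd_subset[OF G, of u] by (auto simp: pointed_def pieces_def)
qed

lemma card_le_ell:
  assumes G: "pair_graph G" and c: "nl_map G c"
    and deg: "\<And>u. u \<in> pverts G \<Longrightarrow> card (nbhd G u) = 1 \<or> card (nbhd G u) = 2"
  shows "card (pverts G) \<le> ell (card (c ` pverts G))"
proof -
  interpret pair_graph G by (rule G)
  have "card (pverts G) = card ((\<lambda>u. (c u, c ` nbhd G u)) ` pverts G)"
    using c by (simp add: nl_map_def card_image)
  also have "\<dots> \<le> card (pointed (pieces (c ` pverts G)))"
  proof (rule card_mono)
    show "finite (pointed (pieces (c ` pverts G)))"
      unfolding pointed_eq by (intro finite_imageI finite_SigmaI finite_pieces) (auto intro: finite_piece)
    show "(\<lambda>u. (c u, c ` nbhd G u)) ` pverts G \<subseteq> pointed (pieces (c ` pverts G))"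
      using colors_in_pointed[OF G c deg] by auto
  qed
  also have "\<dots> = ell (card (c ` pverts G))"
    by (simp add: card_pointed_pieces)
  finally show ?thesis .
qed

text \<open>Arcs running from colour \<open>i\<close> to colour \<open>a\<close> are as many as arcs from \<open>a\<close> to \<open>i\<close>. In a
  2-regular graph, a vertex of colour \<open>i\<close> whose closed neighbourhood has colour set \<open>S\<close> is the tail
  of \<open>4 - card S\<close> arcs into each colour of \<open>S - {i}\<close>; so if exactly one pointed piece is missing,
  the two counts differ.\<close>

lemma card_neq_ell_minus_1:
  assumes G: "pair_graph G" and c: "nl_map G c"
    and deg: "\<And>u. u \<in> pverts G \<Longrightarrow> card (nbhd G u) = 2"
  shows "card (pverts G) + 1 \<noteq> ell (card (c ` pverts G))"
proof
  assume eq: "card (pverts G) + 1 = ell (card (c ` pverts G))"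
  interpret pair_graph G by (rule G)
  define V where "V = pverts G"
  define K where "K = pieces (c ` V)"
  define f where "f u = (c u, c ` nbhd G u)" for u
  have "finite V" by (simp add: V_def)
  then have "finite K" by (simp add: K_def finite_pieces)
  have finK: "finite (pointed K)"
    unfolding pointed_eq by (intro finite_imageI finite_SigmaI \<open>finite K\<close>) (auto simp: K_def intro: finite_piece)
  have sub: "f ` V \<subseteq> pointed K"
    using colors_in_pointed[OF G c] deg by (auto simp: f_def K_def V_def)
  have injf: "inj_on f V" using c by (simp add: nl_map_def f_def[abs_def] V_def)
  have "card (pointed K) = card V + 1"
    using eq \<open>finite V\<close> by (simp add: K_def card_pointed_pieces flip: V_def)
  then have "card (pointed K - f ` V) = 1"
    using card_Diff_subset[OF finite_imageI[OF \<open>finite V\<close>] sub] card_image[OF injf] by simp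
  then obtain i N where miss: "pointed K - f ` V = {(i, N)}"
    by (auto simp: card_1_singleton_iff)
  define S where "S = insert i N"
  have S: "S \<in> K" "i \<notin> N" using miss by (auto simp: pointed_def S_def)
  then have "card S = 2 \<or> card S = 3" by (auto simp: K_def pieces_def)
  then obtain a where a: "a \<in> N" "a \<noteq> i"
    using S(2) by (cases "N = {}") (auto simp: S_def)
  define E where "E x y = {(u, v) \<in> parcs G. c u = x \<and> c v = y}" for x y
  have "bij_betw prod.swap (E i a) (E a i)"
    by (rule bij_betw_imageI) (auto simp: E_def image_iff intro: arcs_symmetric)
  then have sym: "card (E i a) = card (E a i)" by (rule bij_betw_same_card)
  have count: "card (E x y) = (\<Sum>T | T \<in> K \<and> x \<in> T \<and> y \<in> T \<and> (x, T - {x}) \<in> f ` V. 4 - card T)"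
    if "x \<noteq> y" for x y
  proof -
    \<comment> \<open>Arcs are grouped by tail: \<open>U\<close> holds the tails, and
      \<open>g u\<close> is the colour set of the closed neighbourhood of \<open>u\<close>.\<close>
    define U where "U = {u \<in> V. c u = x \<and> y \<in> c ` nbhd G u}"
    define g where "g u = insert (c u) (c ` nbhd G u)" for u
    have "E x y = (SIGMA u:U. {v \<in> nbhd G u. c v = y})"
      by (auto simp: E_def U_def nbhd_def V_def dest: in_arcsD1)
    moreover have "finite (nbhd G u)" if "u \<in> U" for u
      using deg that by (intro card_ge_0_finite) (auto simp: U_def V_def)
    ultimately have "card (E x y) = (\<Sum>u\<in>U. card {v \<in> nbhd G u. c v = y})"
      using \<open>finite V\<close> by (simp add: card_SigmaI U_def)
    also have "\<dots> = (\<Sum>u\<in>U. 4 - card (g u))"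
    proof (rule sum.cong[OF refl])
      fix u assume u: "u \<in> U"
      then have "card (nbhd G u) = 2" "c u \<notin> c ` nbhd G u"
        using deg c by (auto simp: U_def V_def nl_map_def)
      moreover from this obtain p q where pq: "nbhd G u = {p, q}" "p \<noteq> q"
        by (auto simp: card_2_iff)
      moreover have "{v. (v = p \<or> v = q) \<and> c v = y} =
          (if c p = y then {p} else {}) \<union> (if c q = y then {q} else {})"
        by auto
      ultimately show "card {v \<in> nbhd G u. c v = y} = 4 - card (g u)"
        using u by (auto simp: U_def g_def)
    qed
    \<comment> \<open>All tails have colour \<open>x\<close>, so \<open>g u\<close> determines the
      type \<open>f u\<close> and hence \<open>u\<close>; the sum can run over colour sets.\<close>
    also have "\<dots> = (\<Sum>T\<in>g ` U. 4 - card T)"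
    proof (rule sum.reindex_cong[symmetric, where l = g])
      show "inj_on g U"
      proof (rule inj_onI)
        fix u v assume uv: "u \<in> U" "v \<in> U" "g u = g v"
        then have "c u = c v" "c u \<notin> c ` nbhd G u" "c v \<notin> c ` nbhd G v"
          using c by (auto simp: U_def nl_map_def V_def)
        with uv(3) have "f u = f v" by (simp add: g_def f_def insert_ident)
        then show "u = v" using injf uv by (auto simp: U_def dest: inj_onD)
      qed
    qed simp_all
    also have "g ` U = {T. T \<in> K \<and> x \<in> T \<and> y \<in> T \<and> (x, T - {x}) \<in> f ` V}"
    proof (intro subset_antisym subsetI)
      fix T assume "T \<in> g ` U"
      then obtain u where u: "u \<in> U" "T = g u" by auto
      then have "f u \<in> pointed K" "f u \<in> f ` V" using sub by (auto simp: U_def)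
      with u show "T \<in> {T. T \<in> K \<and> x \<in> T \<and> y \<in> T \<and> (x, T - {x}) \<in> f ` V}"
        by (auto simp: pointed_def f_def g_def U_def)
    next
      fix T assume T: "T \<in> {T. T \<in> K \<and> x \<in> T \<and> y \<in> T \<and> (x, T - {x}) \<in> f ` V}"
      then obtain u where "u \<in> V" "c u = x" "c ` nbhd G u = T - {x}" by (auto simp: f_def)
      with T that show "T \<in> g ` U" by (intro image_eqI[of _ _ u]) (auto simp: g_def U_def)
    qed
    finally show ?thesis .
  qed
  define F where "F = {T \<in> K. i \<in> T \<and> a \<in> T}"
  \<comment> \<open>The only missing type has base point \<open>i\<close>, so at \<open>a\<close>
    every set in \<open>F\<close> counts.\<close>
  have "card (E a i) = (\<Sum>T\<in>F. 4 - card T)"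
  proof -
    have "(a, T - {a}) \<in> f ` V" if "T \<in> K" "a \<in> T" for T
    proof -
      have "(a, T - {a}) \<in> pointed K" using that by (simp add: pointed_def insert_absorb)
      then show ?thesis using miss a(2) by auto
    qed
    then have "{T. T \<in> K \<and> a \<in> T \<and> i \<in> T \<and> (a, T - {a}) \<in> f ` V} = F"
      by (auto simp: F_def)
    then show ?thesis using count[OF a(2)] by simp
  qed
  moreover have "card (E i a) = (\<Sum>T\<in>F - {S}. 4 - card T)"
  proof -
    have "(i, T - {i}) \<in> f ` V \<longleftrightarrow> T \<noteq> S" if "T \<in> K" "i \<in> T" for T
    proof -
      have "(i, T - {i}) \<in> pointed K" using that by (simp add: pointed_def insert_absorb)
      then have "(i, T - {i}) \<in> f ` V \<longleftrightarrow> (i, T - {i}) \<notin> pointed K - f ` V" by simp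
      also have "\<dots> \<longleftrightarrow> T - {i} \<noteq> N" by (simp only: miss) simp
      also have "\<dots> \<longleftrightarrow> T \<noteq> S"
        using that S(2) by (metis S_def insert_Diff Diff_insert_absorb)
      finally show ?thesis .
    qed
    then have "{T. T \<in> K \<and> i \<in> T \<and> a \<in> T \<and> (i, T - {i}) \<in> f ` V} = F - {S}"
      by (auto simp: F_def)
    then show ?thesis using count[of i a] a(2) by simp
  qed
  \<comment> \<open>The term lost at \<open>i\<close> is \<open>4 - card S\<close>, which is 2 or 1,
    so the two arc counts cannot agree.\<close>
  moreover have "(\<Sum>T\<in>F. 4 - card T) = 4 - card S + (\<Sum>T\<in>F - {S}. 4 - card T)"
    by (rule sum.remove) (use S a \<open>finite K\<close> in \<open>auto simp: F_def S_def\<close>)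
  ultimately show False
    using sym \<open>card S = 2 \<or> card S = 3\<close> by auto
qed

section \<open>Splicing digons and triangles into words\<close>

text \<open>The argument \<open>P\<close> collects the colours seen by the head of the word before it; at an end of the
  path it is empty.\<close>

fun profile :: "'a set \<Rightarrow> 'a list \<Rightarrow> ('a \<times> 'a set) list" where
  "profile P [] = []"
| "profile P [x] = [(x, P)]"
| "profile P (x # y # zs) = (x, insert y P) # profile {x} (y # zs)"

lemma length_profile [simp]: "length (profile P w) = length w"
  by (induction P w rule: profile.induct) auto

lemma nth_profile:
  assumes "i < length w"
  shows "profile P w ! i = (w ! i,
    (if i = 0 then P else {w ! (i - 1)}) \<union> (if Suc i < length w then {w ! Suc i} else {}))"
  using assms
proof (induction P w arbitrary: i rule: profile.induct)
  case (3 P x y zs)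
  then show ?case by (cases i) (auto simp: nth_Cons')
qed auto

text \<open>\<open>L\<close> is chosen before \<open>vs\<close>: the entries up to the displayed
  \<open>a\<close> are settled once \<open>b\<close> is known, so whatever follows \<open>b\<close>
  can be exchanged.\<close>

lemma profile_append:
  "\<exists>L. \<forall>vs. profile P (us @ a # b # vs) = L @ profile {a} (b # vs)"
proof (induction us arbitrary: P)
  case Nil
  then show ?case by (intro exI[of _ "[(a, insert b P)]"]) simp
next
  case (Cons u us)
  show ?case
  proof (cases us)
    case Nil
    then show ?thesis by (intro exI[of _ "[(u, insert a P), (a, {b, u})]"]) simp
  next
    case (Cons u' us')
    from Cons.IH[of "{u}"] obtain L where "\<forall>vs. profile {u} (us @ a # b # vs) = L @ profile {a} (b # vs)"
      by blast
    then show ?thesis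
      using Cons by (intro exI[of _ "(u, insert u' P) # L"]) simp
  qed
qed

section \<open>Realised pieces and the splice\<close>

definition edges :: "'a list \<Rightarrow> 'a set set" where
  "edges w = {{a, b} |a b. \<exists>us vs. w = us @ a # b # vs}"

lemma edges_Nil [simp]: "edges [] = {}"
  and edges_single [simp]: "edges [x] = {}"
  and edges_Cons2 [simp]: "edges (x # y # zs) = insert {x, y} (edges (y # zs))"
proof -
  show "edges [] = {}" "edges [x] = {}"
    by (auto simp: edges_def Cons_eq_append_conv)
  show "edges (x # y # zs) = insert {x, y} (edges (y # zs))"
  proof (intro subset_antisym subsetI)
    fix e assume "e \<in> edges (x # y # zs)"
    then obtain a b us vs where e: "e = {a, b}" and eq: "x # y # zs = us @ a # b # vs"
      by (auto simp: edges_def)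
    from eq show "e \<in> insert {x, y} (edges (y # zs))"
      by (cases us) (auto simp: e edges_def)
  next
    fix e assume "e \<in> insert {x, y} (edges (y # zs))"
    then consider "e = {x, y}" | a b us vs where "e = {a, b}" "y # zs = us @ a # b # vs"
      by (auto simp: edges_def)
    then show "e \<in> edges (x # y # zs)"
    proof cases
      case 1
      moreover have "x # y # zs = [] @ x # y # zs" by simp
      ultimately show ?thesis unfolding edges_def by blast
    next
      case 2
      then have "x # y # zs = (x # us) @ a # b # vs" by simp
      with 2(1) show ?thesis unfolding edges_def by blast
    qed
  qed
qed

lemma edges_append: "edges (us @ a # vs) = edges (us @ [a]) \<union> edges (a # vs)"
proof (induction us)
  case (Cons u us)
  show ?case
  proof (cases us)
    case (Cons u' us')
    then show ?thesis using Cons.IH by auto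
  qed simp
qed simp

text \<open>\<open>X\<close> holds the types left out: none for closed words, one for the
  exceptional path. The clause on edges is the invariant that keeps splicing possible.\<close>

definition realizes :: "('a \<times> 'a set) set \<Rightarrow> 'a list \<Rightarrow> 'a set set \<Rightarrow> bool" where
  "realizes X w F \<longleftrightarrow> distinct (profile {} w) \<and> set (profile {} w) = pointed F - X \<and> X \<subseteq> pointed F \<and>
     (\<forall>S\<in>F. \<forall>e. e \<subseteq> S \<and> card e = 2 \<longrightarrow> e \<in> edges w)"

text \<open>A word is closed up into a cycle through its first two and last two letters, so splices
  must preserve these.\<close>

definition same_ends :: "'a list \<Rightarrow> 'a list \<Rightarrow> bool" where
  "same_ends w w' \<longleftrightarrow> take 2 w' = take 2 w \<and> take 2 (rev w') = take 2 (rev w)"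

lemma take_2_append: "take 2 (us @ a # b # vs) = take 2 (us @ a # b # vs')"
  by (cases us rule: remdups_adj.cases) (simp_all add: eval_nat_numeral)

lemma same_ends_insert: "same_ends (us @ a # b # vs) (us @ a # b # zs @ a # b # vs)"
  using take_2_append[of us a b "zs @ a # b # vs" vs]
    take_2_append[of "rev vs" b a "rev zs @ b # a # rev us" "rev us"]
  by (simp only: same_ends_def rev_append rev.simps append_assoc append.simps)

lemma two_subset_triple:
  assumes "e \<subseteq> {a, b, c}" "card e = 2"
  shows "e \<in> {{a, b}, {a, c}, {b, c}}"
proof -
  obtain x y where xy: "e = {x, y}" "x \<noteq> y"
    using assms(2) unfolding card_2_iff by blast
  then have "x \<in> {a, b, c}" "y \<in> {a, b, c}" using assms(1) by blast+
  then show ?thesis using xy by auto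
qed

text \<open>An adjacent pair \<open>a b\<close> is replaced by \<open>a b a b\<close> or \<open>a b c a b\<close>. All old positions keep their
  neighbours' colours, and the new ones contribute exactly the pointed versions of \<open>S\<close>.\<close>

lemma realizes_insert:
  assumes w: "realizes X w F" and S: "S \<notin> F" "card S = 2 \<or> card S = 3"
    and e: "e \<subseteq> S" "card e = 2" "e \<in> edges w"
  shows "\<exists>w'. realizes X w' (insert S F) \<and> same_ends w w'"
proof -
  from e(3)[unfolded edges_def] obtain a b us vs where ab: "e = {a, b}" and w_eq: "w = us @ a # b # vs"
    by blast
  have "a \<noteq> b" using e(2) by (auto simp: ab)
  obtain L where L: "profile {} (us @ a # b # vs) = L @ profile {a} (b # vs)" for vs
    using profile_append[of "{}" us a b] by blast
  let ?T = "(\<lambda>x. (x, S - {x})) ` S"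
  have disj: "?T \<inter> pointed F = {}"
    using S(1) by (auto simp: pointed_def insert_absorb)
  \<comment> \<open>Common to both cases: \<open>zs\<close> and a second \<open>a b\<close> are
    inserted, \<open>M\<close> lists the new entries, and after \<open>M\<close> the old profile
    resumes at \<open>b\<close>.\<close>
  have *: "realizes X w' (insert S F) \<and> same_ends w w'"
    if w': "w' = us @ a # b # zs @ a # b # vs"
      and M: "profile {a} (b # zs @ a # b # vs) = M @ profile {a} (b # vs)"
      and dM: "distinct M" "set M = ?T"
      and S': "\<forall>e. e \<subseteq> S \<and> card e = 2 \<longrightarrow> e \<in> edges (a # b # zs @ [a, b])"
    for w' zs M
  proof -
    have "profile {} w' = L @ M @ profile {a} (b # vs)"
      using L[of "zs @ a # b # vs"] M w' by simp
    then have ps: "distinct (profile {} w') \<longleftrightarrow> distinct (M @ profile {} w)"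
      "set (profile {} w') = set M \<union> set (profile {} w)"
      using L w_eq by auto
    have ed: "edges w' = edges (us @ [a]) \<union> edges (a # b # zs @ [a, b]) \<union> edges (b # vs)"
      using edges_append[of us a "b # zs @ a # b # vs"] edges_append[of "a # b # zs @ [a]" b vs] w' by auto
    have "edges w \<subseteq> edges w'"
      using edges_append[of us a "b # vs"] \<open>a \<noteq> b\<close> edges_append[of "a # b # zs" a "[b]"]
      by (auto simp: ed w_eq)
    then have "e' \<in> edges w'" if "T \<in> insert S F" "e' \<subseteq> T" "card e' = 2" for T e'
    proof (cases "T = S")
      case True
      then have "e' \<in> edges (a # b # zs @ [a, b])" using S' that by blast
      then show ?thesis unfolding ed by blast
    next
      case False
      then have "e' \<in> edges w" using w that unfolding realizes_def by blast
      then show ?thesis using \<open>edges w \<subseteq> edges w'\<close> by blast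
    qed
    moreover have "distinct (profile {} w')"
      using w disj dM unfolding ps(1) realizes_def by (auto simp: disjoint_iff)
    moreover have "set (profile {} w') = pointed (insert S F) - X"
      using w disj dM unfolding ps(2) pointed_insert realizes_def by (auto simp only:)
    moreover have "X \<subseteq> pointed (insert S F)"
      using w by (auto simp: realizes_def pointed_insert)
    ultimately have "realizes X w' (insert S F)"
      unfolding realizes_def by blast
    moreover have "same_ends w w'"
      unfolding w' w_eq by (rule same_ends_insert)
    ultimately show ?thesis ..
  qed
  from S(2) show ?thesis
  proof
    assume c2: "card S = 2"
    then have "S = {a, b}"
      using e ab by (metis card_subset_eq card.infinite zero_neq_numeral)
    moreover have "e \<in> {{a, b}}" if "e \<subseteq> {a, b}" "card e = 2" for e
      using that \<open>a \<noteq> b\<close> by (metis card_2_iff card_subset_eq finite.emptyI finite.insertI singletonI)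
    \<comment> \<open>In \<open>a b a b\<close>, the first \<open>b\<close> sees only
      \<open>a\<close> and the second \<open>a\<close> only \<open>b\<close>; the outer letters keep
      their old entries.\<close>
    ultimately show ?thesis
      using \<open>a \<noteq> b\<close>
      by - (rule exI, rule * [where zs="[]" and M="[(b, {a}), (a, {b})]", OF refl], auto)
  next
    assume c3: "card S = 3"
    then have "card (S - e) = 1"
      using e by (simp add: card_Diff_subset card_ge_0_finite)
    then obtain c where "S - e = {c}" unfolding One_nat_def card_1_singleton_iff by blast
    then have "S = insert c e" "c \<notin> e" using e(1) by blast+
    then have "S = {a, b, c}" "c \<noteq> a" "c \<noteq> b" by (simp_all add: ab insert_commute)
    moreover note two_subset_triple[of _ a b c]
    \<comment> \<open>In \<open>a b c a b\<close>, the three middle letters are the three base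
      points, each between the other two.\<close>
    ultimately show ?thesis
      using \<open>a \<noteq> b\<close>
      by - (rule exI, rule * [where zs="[c]" and M="[(b, {a, c}), (c, {a, b}), (a, {b, c})]", OF refl],
        auto simp: insert_commute)
  qed
qed

section \<open>Supply of triangles and digons\<close>

definition triangles :: "'a set \<Rightarrow> 'a set set" where
  "triangles A = {S. S \<subseteq> A \<and> card S = 3}"

definition digons :: "'a set \<Rightarrow> 'a set set" where
  "digons A = {S. S \<subseteq> A \<and> card S = 2}"

lemma pieces_eq: "pieces A = digons A \<union> triangles A"
  by (auto simp: pieces_def digons_def triangles_def)

lemma finite_triangles: "finite A \<Longrightarrow> finite (triangles A)"
  and finite_digons: "finite A \<Longrightarrow> finite (digons A)"
  by (simp_all add: triangles_def digons_def)

lemma card_triangles: "finite A \<Longrightarrow> card (triangles A) = card A choose 3"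
  and card_digons: "finite A \<Longrightarrow> card (digons A) = card A choose 2"
  by (simp_all add: triangles_def digons_def n_subsets)

lemma same_ends_refl: "same_ends w w"
  by (simp add: same_ends_def)

lemma same_ends_trans: "same_ends w w' \<Longrightarrow> same_ends w' w'' \<Longrightarrow> same_ends w w''"
  by (simp add: same_ends_def)

lemma length_realizes:
  assumes "realizes X w F" "finite X"
  shows "length w = card (pointed F) - card X"
proof -
  have "length w = card (set (profile {} w))"
    using assms distinct_card[of "profile {} w"] by (simp add: realizes_def)
  also have "\<dots> = card (pointed F - X)"
    using assms by (simp add: realizes_def)
  also have "\<dots> = card (pointed F) - card X"
    using assms by (simp add: realizes_def card_Diff_subset)
  finally show ?thesis .
qed

text \<open>Otherwise every triangle over \<open>A\<close> with an edge in \<open>w\<close> lies in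
  \<open>F\<close>, so all its edges are in \<open>w\<close>. Starting from \<open>p q\<close>, this
  yields every \<open>{p, x}\<close>, then every \<open>{x, y}\<close>, hence an edge of
  \<open>S\<close> and the contradiction \<open>S \<in> F\<close>.\<close>

lemma triangle_attachable:
  assumes w: "realizes X w F" and pq: "p \<in> A" "q \<in> A" "p \<noteq> q" "{p, q} \<in> edges w"
    and S: "S \<in> triangles A" "S \<notin> F"
  shows "\<exists>S\<in>triangles A - F. \<exists>e. e \<subseteq> S \<and> card e = 2 \<and> e \<in> edges w"
proof (rule ccontr)
  assume neg: "\<not> ?thesis"
  have F: "{x, y, z} \<in> F" if "x \<in> A" "y \<in> A" "z \<in> A" "x \<noteq> y" "y \<noteq> z" "x \<noteq> z" "{x, y} \<in> edges w" for x y z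
  proof (rule ccontr)
    assume "{x, y, z} \<notin> F"
    then have "{x, y, z} \<in> triangles A - F" using that by (simp add: triangles_def)
    moreover have "{x, y} \<subseteq> {x, y, z}" "card {x, y} = 2" using that by auto
    ultimately show False using neg that by blast
  qed
  have E: "{y, z} \<in> edges w" if "{x, y, z} \<in> F" "y \<noteq> z" for x y z
  proof -
    have "{y, z} \<subseteq> {x, y, z}" "card {y, z} = 2" using that by auto
    then show ?thesis using w that unfolding realizes_def by blast
  qed
  have px: "{p, x} \<in> edges w" if "x \<in> A" "x \<noteq> p" for x
  proof (cases "x = q")
    case False
    then have "{p, q, x} \<in> F" using F that pq by auto
    then have "{q, p, x} \<in> F" by (simp add: insert_commute)
    then show ?thesis using E that by blast
  qed (use pq in simp)
  have xy: "{x, y} \<in> edges w" if "x \<in> A" "y \<in> A" "x \<noteq> y" for x y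
  proof -
    consider "x = p" | "y = p" | "x \<noteq> p" "y \<noteq> p" by blast
    then show ?thesis
    proof cases
      case 1
      then show ?thesis using px that by simp
    next
      case 2
      then show ?thesis using px[of x] that by (simp add: insert_commute)
    next
      case 3
      then have "{p, x, y} \<in> F" using F[of p x y] px[of x] that pq by auto
      then show ?thesis using E that by blast
    qed
  qed
  obtain x y z where "S = {x, y, z}" "x \<noteq> y" "x \<noteq> z" "y \<noteq> z"
    using S(1) unfolding triangles_def card_3_iff by blast
  then show False
    using F[of x y z] xy[of x y] S by (simp add: triangles_def)
qed

text \<open>The digon \<open>{p, q}\<close> stays an edge of every extension, so some triangle can
  be attached as long as any remain. Only their number is prescribed.\<close>

lemma realizes_add_triangles:
  assumes w: "realizes X w F" and pq: "p \<in> A" "q \<in> A" "p \<noteq> q" "{p, q} \<in> F"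
    and A: "finite A" and j: "j \<le> card (triangles A - F)"
  shows "\<exists>T w'. T \<subseteq> triangles A - F \<and> card T = j \<and> realizes X w' (F \<union> T) \<and> same_ends w w'"
  using j
proof (induction j)
  case 0
  then show ?case using w same_ends_refl by (intro exI[of _ "{}"] exI[of _ w]) simp
next
  case (Suc j)
  then obtain T w' where T: "T \<subseteq> triangles A - F" "card T = j"
    and w': "realizes X w' (F \<union> T)" "same_ends w w'"
    by auto
  have fin: "finite (triangles A - F)" using finite_triangles[OF A] by simp
  have "T \<noteq> triangles A - F" using T Suc.prems by auto
  then obtain S where "S \<in> triangles A" "S \<notin> F \<union> T" using T(1) by blast
  moreover have "{p, q} \<in> edges w'"
    using w'(1) pq unfolding realizes_def by (metis UnI1 card_2_iff subset_refl)
  ultimately obtain S e where S: "S \<in> triangles A - (F \<union> T)"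
    and e: "e \<subseteq> S" "card e = 2" "e \<in> edges w'"
    using triangle_attachable[OF w'(1) pq(1-3)] by blast
  have "S \<notin> F \<union> T" "card S = 2 \<or> card S = 3" using S by (auto simp: triangles_def)
  from realizes_insert[OF w'(1) this e] obtain w'' where
    "realizes X w'' (insert S (F \<union> T))" "same_ends w' w''" by blast
  moreover have "card (insert S T) = Suc j"
    using S T finite_subset[OF T(1) fin] by simp
  ultimately show ?case
    using S T w'(2) by (intro exI[of _ "insert S T"] exI[of _ w'']) (auto intro: same_ends_trans)
qed

text \<open>A digon inside a realised piece is already an edge of the word, so digons can be spliced
  in any order.\<close>

lemma realizes_add_digons:
  assumes "finite D" "realizes X w F" "D \<inter> F = {}"
    and "\<And>e. e \<in> D \<Longrightarrow> card e = 2 \<and> (\<exists>S\<in>F. e \<subseteq> S)"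
  shows "\<exists>w'. realizes X w' (F \<union> D) \<and> same_ends w w'"
  using assms
proof (induction D rule: finite_induct)
  case empty
  then show ?case using same_ends_refl by auto
next
  case (insert e D)
  then obtain w' where w': "realizes X w' (F \<union> D)" "same_ends w w'" by auto
  obtain S where "card e = 2" "S \<in> F" "e \<subseteq> S" using insert.prems(3) by blast
  moreover from this have "e \<in> edges w'" using w'(1) unfolding realizes_def by blast
  moreover have "e \<notin> F \<union> D" using insert by auto
  ultimately obtain w'' where "realizes X w'' (insert e (F \<union> D))" "same_ends w' w''"
    using realizes_insert[OF w'(1), of e e] by blast
  then show ?case using w'(2) same_ends_trans by auto
qed

text \<open>With at least four colours, \<open>e\<close> extends to two different triangles, and at
  most one triangle is absent from \<open>T\<close>.\<close>

lemma digon_covered: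
  assumes A: "card A \<ge> 4" and e: "e \<in> digons A"
    and T: "card (triangles A - T) \<le> 1"
  shows "\<exists>S\<in>T. e \<subseteq> S"
proof (rule ccontr)
  assume neg: "\<not> ?thesis"
  have finA: "finite A" using A by (intro card_ge_0_finite) simp
  have fe: "finite e" "e \<subseteq> A" "card e = 2" using e finA by (auto simp: digons_def finite_subset)
  then have "card (A - e) \<ge> 2" using A by (simp add: card_Diff_subset)
  then obtain B where "B \<subseteq> A - e" "card B = 2" by (meson obtain_subset_with_card_n)
  then obtain z z' where z: "z \<in> A - e" "z' \<in> A - e" "z \<noteq> z'" by (auto simp: card_2_iff)
  then have "{insert z e, insert z' e} \<subseteq> triangles A - T"
    using neg fe by (auto simp: triangles_def)
  moreover have "insert z e \<noteq> insert z' e" using z by blast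
  then have "card {insert z e, insert z' e} = 2" by simp
  ultimately show False
    using T card_mono[of "triangles A - T" "{insert z e, insert z' e}"] finite_triangles[OF finA] by simp
qed

lemma card_pointed_Un:
  assumes "finite D" "finite T" "\<And>S. S \<in> D \<Longrightarrow> card S = 2" "\<And>S. S \<in> T \<Longrightarrow> card S = 3"
  shows "card (pointed (D \<union> T)) = 2 * card D + 3 * card T"
proof -
  have "finite S" if "S \<in> D \<union> T" for S
    using that assms(3)[of S] assms(4)[of S] by (intro card_ge_0_finite) auto
  then have "card (pointed (D \<union> T)) = (\<Sum>S\<in>D \<union> T. card S)"
    using assms by (intro card_pointed) auto
  also have "\<dots> = (\<Sum>S\<in>D. card S) + (\<Sum>S\<in>T. card S)"
    using assms by (intro sum.union_disjoint) fastforce+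
  finally show ?thesis using assms by simp
qed

text \<open>The bound \<open>1 \<le> d\<close> leaves room for the seed digon. The last disjunct
  secures enough digons: one triangle contains three, and with at most one triangle absent all
  digons are covered.\<close>

lemma digon_triangle_counts:
  fixes m T D :: nat
  assumes "4 \<le> T" "6 \<le> D" "7 \<le> m" "m \<le> 3 * T + 2 * D" "m + 1 \<noteq> 3 * T + 2 * D"
  shows "\<exists>t d. m = 2 * d + 3 * t \<and> 1 \<le> t \<and> t \<le> T \<and> 1 \<le> d \<and> d \<le> D \<and> (d \<le> 3 \<or> T \<le> t + 1)"
proof (cases "m \<le> 3 * T + 2")
  case True
  \<comment> \<open>The residue of \<open>m\<close> modulo 3 decides which \<open>d\<close>
    works.\<close>
  have "\<exists>d t. 1 \<le> d \<and> d \<le> 3 \<and> m = 2 * d + 3 * t \<and> 1 \<le> t"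
    using assms(3) by presburger
  then obtain d t where "1 \<le> d" "d \<le> 3" "m = 2 * d + 3 * t" "1 \<le> t" by blast
  then show ?thesis using True assms by (intro exI[of _ t] exI[of _ d]) linarith
next
  case False
  show ?thesis
  proof (cases "even (m - 3 * T)")
    case True
    then obtain d where "m - 3 * T = 2 * d" by blast
    then show ?thesis using False assms by (intro exI[of _ T] exI[of _ d]) linarith
  next
    \<comment> \<open>For odd remainder one triangle is given up. The excluded value of
      \<open>m\<close> is the one that would need \<open>D + 1\<close> digons.\<close>
    case odd: False
    then have "even (m + 3 - 3 * T)" using False by (simp add: even_diff_nat)
    then obtain d where "m + 3 - 3 * T = 2 * d" by blast
    then have md: "m + 3 = 2 * d + 3 * T" using False by linarith
    then have "d \<noteq> D + 1" "\<not> D + 2 \<le> d" "1 \<le> d" using False assms(4,5) by linarith+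
    moreover obtain u where "T = Suc u" "1 \<le> u" using assms(1) by (cases T) auto
    moreover from this have "m = 2 * d + 3 * u" using md by simp
    ultimately show ?thesis by (intro exI[of _ u] exI[of _ d]) simp
  qed
qed

section \<open>Words of the required lengths\<close>

lemma choose_ge:
  assumes "k \<ge> 4"
  shows "4 \<le> k choose 3" "6 \<le> k choose 2"
  using binomial_right_mono[OF assms, of 3] binomial_right_mono[OF assms, of 2]
  by (simp_all add: numeral_eq_Suc)

text \<open>The seed \<open>0 1\<close> realises the digon \<open>{0, 1}\<close> and both begins and
  ends with \<open>0 1\<close>. Splicing in \<open>t\<close> triangles and then \<open>d - 1\<close>
  digons keeps the ends, and each piece adds as many letters as it has elements.\<close>

lemma exists_closed_word:
  assumes k: "k \<ge> 4" and m: "7 \<le> m" "m \<le> ell k" "m + 1 \<noteq> ell k"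
  shows "\<exists>w F. realizes {} w F \<and> F \<subseteq> pieces {..<k} \<and> length w = m \<and> same_ends [0, 1 :: nat] w"
proof -
  obtain t d where td: "m = 2 * d + 3 * t" "1 \<le> t" "t \<le> k choose 3" "1 \<le> d" "d \<le> k choose 2"
    "d \<le> 3 \<or> k choose 3 \<le> t + 1"
    using digon_triangle_counts[OF choose_ge[OF k] m(1)] m(2,3) unfolding choose_ell[symmetric]
    by (metis add.commute)
  define A where "A = {..<k}"
  have A: "finite A" "card A = k" "0 \<in> A" "1 \<in> A" using k by (auto simp: A_def)
  have base: "realizes {} [0, 1 :: nat] {{0, 1}}"
    unfolding realizes_def pointed_insert pointed_empty
  proof (intro conjI ballI allI impI)
    fix S e :: "nat set" assume "S \<in> {{0, 1}}" "e \<subseteq> S \<and> card e = 2"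
    then have "e = {0, 1}" by (intro card_subset_eq) auto
    then show "e \<in> edges [0, 1]" by simp
  qed auto
  have dj: "triangles A - {{0, 1}} = triangles A"
    by (auto simp: triangles_def)
  obtain T w where T: "T \<subseteq> triangles A" "card T = t" and w: "realizes {} w ({{0, 1}} \<union> T)" "same_ends [0, 1] w"
    using realizes_add_triangles[OF base A(3,4) _ _ A(1), of t] td(3) unfolding dj
    by (auto simp: card_triangles A)
  have finT: "finite T" using T(1) finite_triangles[OF A(1)] finite_subset by blast
  \<comment> \<open>The digons inside a chosen triangle are those known to be edges of
    \<open>w\<close>.\<close>
  define Q where "Q = {e \<in> digons A. \<exists>S\<in>T. e \<subseteq> S}"
  have finQ: "finite Q" using finite_digons[OF A(1)] by (simp add: Q_def)
  have "d \<le> card Q"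
    using td(6)
  proof
    assume "d \<le> 3"
    obtain S where S: "S \<in> T" using T td(2) by (metis card.empty ex_in_conv not_one_le_zero)
    then have "S \<subseteq> A" "card S = 3" using T by (auto simp: triangles_def)
    moreover from this have "card (digons S) = 3"
      using card_digons[OF finite_subset[OF _ A(1)], of S] by (simp add: numeral_eq_Suc)
    moreover have "digons S \<subseteq> Q"
      using S \<open>S \<subseteq> A\<close> unfolding Q_def digons_def by blast
    ultimately have "3 \<le> card Q"
      using card_mono[OF finQ, of "digons S"] by simp
    then show ?thesis using \<open>d \<le> 3\<close> by simp
  next
    assume "k choose 3 \<le> t + 1"
    then have "card (triangles A - T) \<le> 1"
      using T finT by (simp add: card_Diff_subset card_triangles A)
    then have "Q = digons A"
      using digon_covered[of A _ T] k A(2) by (auto simp: Q_def)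
    then show ?thesis using td(5) by (simp add: card_digons A)
  qed
  \<comment> \<open>The seed is already one of the \<open>d\<close> digons; excluding it from
    \<open>Q\<close> costs at most one.\<close>
  then have "d - 1 \<le> card (Q - {{0, 1}})"
    by (auto simp: card_Diff_singleton_if)
  then obtain D where D: "D \<subseteq> Q - {{0, 1}}" "card D = d - 1" "finite D"
    by (rule obtain_subset_with_card_n)
  have "D \<inter> ({{0, 1}} \<union> T) = {}"
    using D(1) T(1) by (force simp: Q_def digons_def triangles_def)
  then obtain w' where w': "realizes {} w' ({{0, 1}} \<union> T \<union> D)" "same_ends w w'"
    using realizes_add_digons[OF D(3) w(1)] D(1) by (auto simp: Q_def digons_def)
  have F: "{{0, 1}} \<union> T \<union> D = insert {0, 1} D \<union> T" by blast
  have "length w' = 2 * card (insert {0, 1} D) + 3 * card T"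
  proof -
    have "card S = 2" if "S \<in> insert {0, 1} D" for S
      using that D(1) by (auto simp: Q_def digons_def)
    moreover have "card S = 3" if "S \<in> T" for S
      using that T(1) by (auto simp: triangles_def)
    ultimately have "card (pointed (insert {0, 1} D \<union> T)) = 2 * card (insert {0, 1} D) + 3 * card T"
      using D(3) finT by (intro card_pointed_Un) simp_all
    then show ?thesis using length_realizes[OF w'(1)] unfolding F by simp
  qed
  also have "\<dots> = m"
    using D T td by (subst card_insert_disjoint) auto
  finally have "length w' = m" .
  moreover have "{{0, 1}} \<union> T \<union> D \<subseteq> pieces A"
    using T D A unfolding pieces_eq by (auto simp: Q_def digons_def)
  ultimately show ?thesis
    using w' w(2) same_ends_trans unfolding A_def by blast
qed

text \<open>From a word of length \<open>ell k\<close> that runs cyclically through \<open>0 2 0 1 0\<close>, deleting the middle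
  \<open>0\<close> and cutting there leaves a path word \<open>1 0 \<dots> 0 2\<close> which misses only the type \<open>(0, {1, 2})\<close>. The
  shortest such word is \<open>1 0 1 2 0 2\<close>.\<close>

lemma exists_word_missing_one:
  assumes k: "k \<ge> 4"
  shows "\<exists>w F X. realizes X w F \<and> F \<subseteq> pieces {..<k :: nat} \<and> length w = ell k - 1"
proof -
  define A where "A = {..<k}"
  have A: "finite A" "card A = k" "0 \<in> A" "1 \<in> A" "2 \<in> A" using k by (auto simp: A_def)
  define X :: "(nat \<times> nat set) set" where "X = {(0, {1, 2})}"
  \<comment> \<open>The pieces of the seed word. Its edge \<open>1 2\<close> is not yet a piece;
    \<open>{1, 2}\<close> is spliced in later with the other digons.\<close>
  define F :: "nat set set" where "F = {{0, 1}, {0, 2}, {0, 1, 2}}"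
  have base: "realizes X [1, 0, 1, 2, 0, 2] F"
    unfolding realizes_def
  proof (intro conjI ballI allI impI)
    fix S e assume "S \<in> F" "e \<subseteq> S \<and> card e = 2"
    moreover from this have "e \<subseteq> {0, 1, 2}" by (auto simp: F_def)
    ultimately have "e \<in> {{0, 1}, {0, 2}, {1, 2}}" by (intro two_subset_triple) auto
    then show "e \<in> edges [1, 0, 1, 2, 0, 2]"
      by (elim insertE emptyE) (simp_all add: insert_commute)
  next
    let ?R = "{(1, {0}), (0, {1 :: nat}), (1, {0, 2}), (2, {0, 1}), (0, {2}), (2 :: nat, {0})}"
    have neq: "{1, 2} \<noteq> {1 :: nat}" "{1, 2} \<noteq> {2 :: nat}" by auto
    have tp: "(\<lambda>x. (x, {0, 1} - {x})) ` {0, 1} = {(0, {1 :: nat}), (1 :: nat, {0})}"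
      "(\<lambda>x. (x, {0, 2} - {x})) ` {0, 2} = {(0, {2 :: nat}), (2 :: nat, {0})}"
      "(\<lambda>x. (x, {0, 1, 2} - {x})) ` {0, 1, 2} = {(0, {1, 2 :: nat}), (1 :: nat, {0, 2}), (2, {0, 1})}"
      by (simp_all add: insert_Diff_if)
    have "pointed F = insert (0, {1, 2}) ?R"
      unfolding F_def pointed_insert tp pointed_empty by (simp add: insert_commute)
    moreover have "insert (0, {1, 2}) ?R - X = ?R"
      using neq by (simp add: X_def)
    moreover have "set (profile {} [1, 0, 1, 2, 0, 2]) = ?R"
      by (simp add: insert_commute)
    ultimately show "set (profile {} [1, 0, 1, 2, 0, 2]) = pointed F - X" "X \<subseteq> pointed F"
      by (simp_all add: X_def)
  qed (auto simp: insert_commute doubleton_eq_iff)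
  obtain T w where T: "T \<subseteq> triangles A - F" "card T = card (triangles A - F)" and w: "realizes X w (F \<union> T)"
    using realizes_add_triangles[OF base A(3,4) _ _ A(1) le_refl] by (auto simp: F_def)
  have fin: "finite (triangles A - F)" using finite_triangles[OF A(1)] by simp
  have "T = triangles A - F" using card_subset_eq[OF fin T] .
  define D where "D = digons A - F"
  have "finite D" using finite_digons[OF A(1)] by (simp add: D_def)
  moreover have "D \<inter> (F \<union> T) = {}"
    using T(1) by (auto simp: D_def digons_def triangles_def)
  moreover have "card e = 2 \<and> (\<exists>S\<in>F \<union> T. e \<subseteq> S)" if "e \<in> D" for e
    using that digon_covered[of A e "triangles A"] k A(2) \<open>T = _\<close> by (auto simp: D_def digons_def)
  ultimately obtain w' where w': "realizes X w' (F \<union> T \<union> D)"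
    using realizes_add_digons[OF _ w] by blast
  have "F \<subseteq> pieces A" using A by (auto simp: F_def pieces_def)
  then have eq: "F \<union> T \<union> D = pieces A"
    using \<open>T = _\<close> by (auto simp: D_def pieces_eq)
  have "length w' = ell k - 1"
    using length_realizes[OF w'] A by (simp add: eq card_pointed_pieces X_def)
  then show ?thesis using w' eq A_def by blast
qed

section \<open>Colorings from words\<close>

text \<open>Positions are vertices and letters are colours. Distinct profile entries separate
  vertices, and a base point never lies in its own neighbour set, so the coloring is proper.\<close>

lemma nl_map_word:
  assumes w: "realizes X w F" "F \<subseteq> pieces A" and A: "finite A"
    and G: "pverts G = {..<length w}"
    and nb: "\<And>i. i < length w \<Longrightarrow> (w ! i, (!) w ` nbhd G i) = profile {} w ! i"
  shows "nl_map G ((!) w) \<and> card ((!) w ` pverts G) \<le> card A"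
proof -
  have mem: "(w ! i, (!) w ` nbhd G i) \<in> pointed F" if "i < length w" for i
  proof -
    have "profile {} w ! i \<in> set (profile {} w)" using that by simp
    then show ?thesis using w(1) nb[OF that] by (auto simp: realizes_def)
  qed
  have "inj_on (\<lambda>i. (w ! i, (!) w ` nbhd G i)) (pverts G)"
  proof (rule inj_onI)
    fix i j assume "i \<in> pverts G" "j \<in> pverts G" "(w ! i, (!) w ` nbhd G i) = (w ! j, (!) w ` nbhd G j)"
    then show "i = j"
      using w(1) nb[of i] nb[of j] G by (simp add: realizes_def nth_eq_iff_index_eq)
  qed
  moreover have "w ! i \<notin> (!) w ` nbhd G i" if "i \<in> pverts G" for i
    using mem[of i] that G by (simp add: pointed_def)
  ultimately have "nl_map G ((!) w)" by (simp add: nl_map_def)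
  moreover have "w ! i \<in> A" if "i \<in> pverts G" for i
    using mem[of i] that G w(2) by (auto simp: pointed_def pieces_def)
  then have "card ((!) w ` pverts G) \<le> card A"
    by (intro card_mono A) auto
  ultimately show ?thesis ..
qed

lemma nbhd_path:
  "i < m \<Longrightarrow> nbhd (path_graph m) i = (if i = 0 then {} else {i - 1}) \<union> (if Suc i < m then {Suc i} else {})"
  by (auto simp: nbhd_def path_graph_def)

lemma nbhd_cycle:
  assumes "m \<ge> 3" "i < m"
  shows "nbhd (cycle_graph m) i = {if i = 0 then m - 1 else i - 1, if Suc i < m then Suc i else 0}"
proof -
  have pred: "i = Suc j mod m \<longleftrightarrow> j = (if i = 0 then m - 1 else i - 1)" if "j < m" for j
    using assms that by (cases "Suc j = m") auto
  have succ: "Suc i mod m = (if Suc i < m then Suc i else 0)"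
    using assms by (cases "Suc i = m") auto
  have "j \<in> nbhd (cycle_graph m) i \<longleftrightarrow>
      j < m \<and> (j = (if Suc i < m then Suc i else 0) \<or> j = (if i = 0 then m - 1 else i - 1))" for j
    using assms pred[of j] unfolding succ[symmetric] by (auto simp: nbhd_def cycle_graph_def)
  moreover have "(if Suc i < m then Suc i else 0) < m" "(if i = 0 then m - 1 else i - 1) < m"
    using assms by auto
  ultimately show ?thesis by blast
qed

lemma chi_NL_cone_path_le:
  assumes "realizes X w F" "F \<subseteq> pieces A" "finite A"
  shows "chi_NL (cone (path_graph (length w))) \<le> card A + 1"
proof -
  let ?G = "path_graph (length w)"
  have "(w ! i, (!) w ` nbhd ?G i) = profile {} w ! i" if "i < length w" for i
    using that by (simp add: nbhd_path nth_profile)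
  then have "nl_map ?G ((!) w) \<and> card ((!) w ` pverts ?G) \<le> card A"
    by (intro nl_map_word[OF assms]) (auto simp: path_graph_def)
  then show ?thesis
    using chi_NL_cone_le[OF pair_graph_path_graph, of "length w" "(!) w"] by simp
qed

text \<open>A word that begins and ends with \<open>a b\<close> may be closed up: the ends then see a second
  neighbour of the colour they already see.\<close>

lemma chi_NL_cone_cycle_le:
  assumes w: "realizes X w F" "F \<subseteq> pieces A" "finite A" and e: "same_ends [a, b] w" "length w \<ge> 3"
  shows "chi_NL (cone (cycle_graph (length w))) \<le> card A + 1"
proof -
  let ?G = "cycle_graph (length w)"
  have tk: "take 2 w = [a, b]" "take 2 (rev w) = [b, a]"
    using e(1) by (simp_all add: same_ends_def)
  have "w ! 0 = take 2 w ! 0" "w ! 1 = take 2 w ! 1" by simp_all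
  moreover have "rev w ! 0 = take 2 (rev w) ! 0" "rev w ! 1 = take 2 (rev w) ! 1" by simp_all
  ultimately have ends: "w ! 0 = a" "w ! Suc 0 = b" "w ! (length w - 1) = b" "w ! (length w - 2) = a"
    unfolding tk using e(2) rev_nth[of 0 w] by (fastforce simp: rev_nth numeral_2_eq_2)+
  have "(w ! i, (!) w ` nbhd ?G i) = profile {} w ! i" if i: "i < length w" for i
  proof -
    consider "i = 0" | "i = length w - 1" | "i \<noteq> 0" "Suc i < length w" using i by linarith
    then show ?thesis
    proof cases
      case 1
      then show ?thesis using i e(2) ends by (auto simp: nbhd_cycle nth_profile)
    next
      case 2
      have "length w - 1 - 1 = length w - 2" by simp
      then show ?thesis using i e(2) ends 2 by (simp add: nbhd_cycle nth_profile)
    next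
      case 3
      then show ?thesis using i e(2) by (simp add: nbhd_cycle nth_profile insert_commute)
    qed
  qed
  then have "nl_map ?G ((!) w) \<and> card ((!) w ` pverts ?G) \<le> card A"
    by (intro nl_map_word[OF w]) (auto simp: cycle_graph_def)
  then show ?thesis
    using chi_NL_cone_le[OF pair_graph_cycle_graph, of "length w" "(!) w"] e(2) by simp
qed

section \<open>Lower bound and the three values\<close>

lemma chi_NL_cone_ge:
  assumes G: "pair_graph G"
    and deg: "\<And>u. u \<in> pverts G \<Longrightarrow> card (nbhd G u) = 1 \<or> card (nbhd G u) = 2"
    and k: "k \<ge> 1" "ell (k - 1) < card (pverts G)"
  shows "chi_NL (cone G) \<ge> k + 1"
proof -
  obtain c :: "'a \<Rightarrow> 'a option set" where c: "nl_map G c" "card (c ` pverts G) + 1 = chi_NL (cone G)"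
    using chi_NL_cone_attained[OF G] by blast
  \<comment> \<open>Fewer than \<open>k\<close> rim colours would offer at most
    \<open>ell (k - 1)\<close> types, too few for the rim.\<close>
  then have "ell (k - 1) < ell (card (c ` pverts G))"
    using card_le_ell[OF G c(1) deg] k(2) by simp
  then have "\<not> card (c ` pverts G) \<le> k - 1"
    using ell_mono by (meson not_le)
  then show ?thesis using c(2) k(1) by simp
qed

theorem theorem20:
  fixes k n :: nat
  assumes "k \<ge> 4"
    and "ell (k - 1) + 1 < n"
    and "n \<le> ell k + 1"
  shows "chi_NL (fan n) = k + 1
    \<and> (n \<noteq> ell k \<longrightarrow> chi_NL (wheel n) = k + 1)
    \<and> (n = ell k \<longrightarrow> chi_NL (wheel n) = k + 2)"
proof -
  define m where "m = n - 1"
  \<comment> \<open>As \<open>ell 3 = 9\<close>, the rim order \<open>m\<close> exceeds the minimum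
    length 7 of the word construction.\<close>
  have "ell 3 \<le> ell (k - 1)" using assms(1) by (intro ell_mono) simp
  then have "9 \<le> ell (k - 1)" by (simp add: ell_def)
  then have m: "m \<ge> 7" "ell (k - 1) < m" "m \<le> ell k" "n = m + 1"
    using assms by (auto simp: m_def)
  \<comment> \<open>\<open>j\<close> will be \<open>k\<close> in general and \<open>k + 1\<close>
    for the exceptional wheel.\<close>
  have word: "\<exists>w F. realizes {} w F \<and> F \<subseteq> pieces {..<j} \<and> length w = m \<and> same_ends [0, 1 :: nat] w"
    if "j \<ge> 4" "m \<le> ell j" "m + 1 \<noteq> ell j" for j
    using exists_closed_word[OF that(1) m(1) that(2,3)] .
  have cyc: "pair_graph (cycle_graph m)" "pverts (cycle_graph m) = {..<m}"
    "\<And>u. u \<in> {..<m} \<Longrightarrow> card (nbhd (cycle_graph m) u) = 2"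
    using pair_graph_cycle_graph[of m] m(1) by (simp_all add: nbhd_cycle) (auto simp: cycle_graph_def)
  have fan_ge: "chi_NL (fan n) \<ge> k + 1"
    unfolding fan_def
    by (rule chi_NL_cone_ge[OF pair_graph_path_graph])
      (use m assms(1) nbhd_path[of _ m] in \<open>auto simp: path_graph_def\<close>)
  have wheel_ge: "chi_NL (wheel n) \<ge> k + 1"
    unfolding wheel_def using cyc m assms(1) by (intro chi_NL_cone_ge) auto
  have wheel_le: "chi_NL (wheel n) \<le> j + 1" if "j \<ge> 4" "m \<le> ell j" "m + 1 \<noteq> ell j" for j
    using word[OF that] chi_NL_cone_cycle_le m(1,4) unfolding wheel_def by fastforce
  have "chi_NL (fan n) \<le> k + 1"
  proof (cases "m + 1 = ell k")
    \<comment> \<open>For this length the word that omits one type takes over.\<close>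
    case True
    then show ?thesis
      using exists_word_missing_one[OF assms(1)] chi_NL_cone_path_le m(4) unfolding fan_def by fastforce
  next
    case False
    then show ?thesis
      using word[OF assms(1) m(3)] chi_NL_cone_path_le m(4) unfolding fan_def by fastforce
  qed
  moreover have "chi_NL (wheel n) = k + 2" if "n = ell k"
  proof -
    obtain c :: "nat \<Rightarrow> nat option set" where c: "nl_map (cycle_graph m) c"
      "card (c ` pverts (cycle_graph m)) + 1 = chi_NL (cone (cycle_graph m))"
      using chi_NL_cone_attained[OF cyc(1)] by blast
    \<comment> \<open>With \<open>k\<close> rim colours, the 2-regular rim would miss exactly one of
      the \<open>ell k\<close> types.\<close>
    have "card (c ` pverts (cycle_graph m)) \<noteq> k"
      using card_neq_ell_minus_1[OF cyc(1) c(1)] cyc(2,3) that m(4) by fastforce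
    then have "chi_NL (wheel n) \<noteq> k + 1" using c(2) m(4) by (simp add: wheel_def)
    \<comment> \<open>By this strict growth, the length \<open>ell k - 1\<close> is no longer
      exceptional over \<open>k + 1\<close> colours.\<close>
    moreover have "ell k < ell (k + 1)"
      using assms(1) choose_ell[of k] choose_ell[of "k + 1"] by (simp add: numeral_eq_Suc)
    then have "chi_NL (wheel n) \<le> (k + 1) + 1"
      using that m(4) assms(1) by (intro wheel_le) auto
    ultimately show ?thesis using wheel_ge by simp
  qed
  ultimately show ?thesis
    using fan_ge wheel_ge wheel_le[OF assms(1) m(3)] m(4) by auto
qed

end
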